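(* Let $v\in\mathbb{N}=\{1,2,\dots\}$ and, for $n\ge\max(v,2)$, let $S_n(v)$ be the number of temporary leaves attached to $v$ at time $n$. If $\mathbf{P}\{Z_v>0\}>0$, then conditional on $Z_v>0$ the family $(S_n(v))_n$ is tight, that is, for all $\varepsilon>0$ there exists a constant $M>0$ such that $$\mathbf{P}\{S_n(v)>M\mid Z_v>0\}<\varepsilon\quad\text{for all } n\ge\max(v,2).$$
   Context: The random friend tree process $(T_n)_{n\ge 2}$ is defined as follows. $T_2$ is a single edge joining vertices labelled $1$ and $2$. For $n\ge 2$, given $T_n$ (and the past of the process), $V_n$ is chosen uniformly at random in $\{1,\dots,n\}$, and then $W_n$ is a uniformly random neighbour of $V_n$ in $T_n$; $T_{n+1}$ is obtained from $T_n$ by adding a new vertex labelled $n+1$ joined by an edge to $W_n$. Thus $T_n$ is a tree with vertex set $[n]=\{1,\dots,n\}$. For $v\in[n]$, $D_n(v)$ is the degree of $v$ in $T_n$ (non-decreasing in $n$), and $Z_v:=\liminf_{n\to\infty} D_n(v)/n$. A vertex $\ell$ that is a leaf at time $m$ (i.e. $D_m(\ell)=1$) is called temporary if $\lim_{n\to\infty}D_n(\ell)>D_m(\ell)=1$. Thus $S_n(v)$ is the number of neighbours $\ell$ of $v$ in $T_n$ with $D_n(\ell)=1$ and $\lim_{j\to\infty}D_j(\ell)>1$. *)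

theory Defs
  imports "HOL-Probability.Probability"
begin

text \<open>
  A graph is represented by its set of undirected edges, each edge being a doubleton of vertices.
\<close>

definition neighbours :: "nat set set \<Rightarrow> nat \<Rightarrow> nat set" where
  "neighbours E i = {u. {u, i} \<in> E}"

definition vertex_degree :: "nat set set \<Rightarrow> nat \<Rightarrow> nat" where
  "vertex_degree E i = card (neighbours E i)"

text \<open>
  The tree \<open>T\<^sub>n\<close> on \<open>{1..n}\<close> in which, for \<open>2 \<le> k < n\<close>, vertex \<open>k + 1\<close> was attached to \<open>w k\<close>.
  It is meaningful for \<open>n \<ge> 2\<close> only; the values at \<open>0\<close> and \<open>1\<close> are dummies.
\<close>

primrec friend_tree :: "(nat \<Rightarrow> nat) \<Rightarrow> nat \<Rightarrow> nat set set" where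
  "friend_tree w 0 = {{1, 2}}"
| "friend_tree w (Suc n) =
     (if n < 2 then {{1, 2}} else insert {w n, Suc n} (friend_tree w n))"

definition degree_at :: "(nat \<Rightarrow> nat) \<Rightarrow> nat \<Rightarrow> nat \<Rightarrow> nat" where
  "degree_at w n i = vertex_degree (friend_tree w n) i"

definition liminf_degree_ratio :: "(nat \<Rightarrow> nat) \<Rightarrow> nat \<Rightarrow> ereal" where
  "liminf_degree_ratio w i = liminf (\<lambda>n. ereal (real (degree_at w n i) / real n))"

text \<open>
  The limit of the degrees is taken in the extended reals, as it may be infinite; it exists because
  degrees are non-decreasing in time.
\<close>

definition temporary_leaf :: "(nat \<Rightarrow> nat) \<Rightarrow> nat \<Rightarrow> nat \<Rightarrow> bool" where
  "temporary_leaf w m l \<longleftrightarrow>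
     degree_at w m l = 1 \<and> lim (\<lambda>n. ereal (real (degree_at w n l))) > ereal (real (degree_at w m l))"

definition num_temporary_leaves :: "(nat \<Rightarrow> nat) \<Rightarrow> nat \<Rightarrow> nat \<Rightarrow> nat" where
  "num_temporary_leaves w n i = card {l \<in> neighbours (friend_tree w n) i. temporary_leaf w n l}"

text \<open>
  The random choices \<open>V\<^sub>n\<close>, \<open>W\<^sub>n\<close> (\<open>n \<ge> 2\<close>) live on an arbitrary probability space. Their conditional
  laws given the past are specified on each possible history \<open>V\<^sub>k = a k\<close>, \<open>W\<^sub>k = b k\<close> (\<open>2 \<le> k < n\<close>)
  of positive probability; on that event the current tree is \<open>friend_tree b n\<close>.
\<close>

locale random_friend_tree = prob_space M for M :: "'a measure" +
  fixes V W :: "nat \<Rightarrow> 'a \<Rightarrow> nat"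
  assumes measurable_V: "\<And>n. n \<ge> 2 \<Longrightarrow> V n \<in> measurable M (count_space UNIV)"
    and measurable_W: "\<And>n. n \<ge> 2 \<Longrightarrow> W n \<in> measurable M (count_space UNIV)"
    and uniform_vertex:
      "\<And>n a b i. n \<ge> 2 \<Longrightarrow>
         \<P>(\<omega> in M. \<forall>k\<in>{2..<n}. V k \<omega> = a k \<and> W k \<omega> = b k) > 0 \<Longrightarrow>
         \<P>(\<omega> in M. V n \<omega> = i \<bar> \<forall>k\<in>{2..<n}. V k \<omega> = a k \<and> W k \<omega> = b k)
           = pmf (pmf_of_set {1..n}) i"
    and uniform_neighbour:
      "\<And>n a b i u. n \<ge> 2 \<Longrightarrow>
         \<P>(\<omega> in M. (\<forall>k\<in>{2..<n}. V k \<omega> = a k \<and> W k \<omega> = b k) \<and> V n \<omega> = i) > 0 \<Longrightarrow>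
         \<P>(\<omega> in M. W n \<omega> = u \<bar> (\<forall>k\<in>{2..<n}. V k \<omega> = a k \<and> W k \<omega> = b k) \<and> V n \<omega> = i)
           = pmf (pmf_of_set (neighbours (friend_tree b n) i)) u"

end

theory Submission
  imports Defs
begin

text \<open>
  A leaf \<open>l\<close> attached to \<open>v\<close> can only receive a new neighbour at a time \<open>m\<close> at which \<open>V\<^sub>m = v\<close> and
  \<open>W\<^sub>m = l\<close>, because \<open>v\<close> is the only vertex from which \<open>l\<close> can be reached. Given the past this has
  probability \<open>1 / (m D\<^sub>m(v))\<close>. If \<open>v\<close> has linear degree, say \<open>D\<^sub>m(v) \<ge> \<delta> m\<close> for all \<open>m \<ge> n\<close>,
  then this is at most \<open>1 / (\<delta> m\<^sup>2)\<close>. Hence the probability that the degree is linear in this sense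
  and a fixed label is a temporary leaf of \<open>v\<close> at time \<open>n\<close> is at most
  \<open>\<Sum>m\<ge>n. 1 / (\<delta> m\<^sup>2) \<le> 2 / (\<delta> n)\<close>. There are only \<open>n\<close> labels, so the expected number of
  temporary leaves on the event of linear degree is at most \<open>2 / \<delta>\<close>, uniformly in \<open>n\<close>, and
  Markov's inequality gives tightness on this event.

  The event \<open>Z\<^sub>v > 0\<close> is the increasing union over \<open>N\<close> of the events
  that, in addition, \<open>D\<^sub>m(v) \<ge> m / (N + 1)\<close> for all \<open>m \<ge> N\<close>. Hence one \<open>N\<close> captures all but an arbitrarily
  small part of its probability, and \<open>\<delta> = 1 / (N + 1)\<close> serves for all \<open>n \<ge> N\<close>; for \<open>n < N\<close> the number of
  leaves is at most \<open>N\<close>. The three ingredients are \<open>temporary_leaf_chosen\<close> (the deterministic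
  part), \<open>prob_chosen_from_le\<close> (the estimate of one label) and \<open>prob_degree_dips_tendsto_0\<close>.
\<close>

section \<open>Growing trees\<close>

lemma neighbours_commute: "u \<in> neighbours E i \<longleftrightarrow> i \<in> neighbours E u"
  by (simp add: neighbours_def insert_commute)

lemma finite_neighbours:
  assumes "finite E"
  shows "finite (neighbours E i)"
proof -
  have "inj_on (\<lambda>u. {u, i}) (neighbours E i)"
    by (auto simp: inj_on_def doubleton_eq_iff)
  moreover have "(\<lambda>u. {u, i}) ` neighbours E i \<subseteq> E"
    by (auto simp: neighbours_def)
  ultimately show ?thesis
    using assms finite_imageD finite_subset by blast
qed

lemma finite_friend_tree: "finite (friend_tree w n)"
  by (induction n) auto

lemma friend_tree_cong:
  assumes "\<And>k. k \<in> {2..<n} \<Longrightarrow> w k = w' k"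
  shows "friend_tree w n = friend_tree w' n"
  using assms by (induction n) auto

lemma friend_tree_le_2: "n \<le> 2 \<Longrightarrow> friend_tree w n = {{1, 2}}"
  by (cases n) auto

lemma friend_tree_mono: "n \<le> m \<Longrightarrow> friend_tree w n \<subseteq> friend_tree w m"
proof (rule lift_Suc_mono_le[where f = "friend_tree w"])
  show "friend_tree w k \<subseteq> friend_tree w (Suc k)" for k
    using friend_tree_le_2[of k w] by auto
qed

lemma neighbours_friend_tree_nonempty:
  assumes "n \<ge> 2" "i \<in> {1..n}"
  shows "neighbours (friend_tree w n) i \<noteq> {}"
  using assms
proof (induction n rule: dec_induct)
  case base
  then have "i = 1 \<or> i = 2" by auto
  then show ?case
    using friend_tree_le_2[of 2 w] by (auto simp: neighbours_def insert_commute)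
next
  case (step n)
  show ?case
  proof (cases "i = Suc n")
    case True
    then show ?thesis using step by (auto simp: neighbours_def)
  next
    case False
    then show ?thesis using step by (force simp: neighbours_def)
  qed
qed

lemma friend_tree_labels:
  assumes choice: "\<And>k. k \<ge> 2 \<Longrightarrow> w k \<in> neighbours (friend_tree w k) (a k)"
    and "n \<ge> 2"
  shows "\<Union>(friend_tree w n) \<subseteq> {1..n}"
  using \<open>n \<ge> 2\<close>
proof (induction n rule: dec_induct)
  case base
  then show ?case using friend_tree_le_2[of 2 w] by auto
next
  case (step n)
  have "{w n, a n} \<in> friend_tree w n"
    using choice[OF step(1)] by (simp add: neighbours_def)
  then have "w n \<in> {1..n}" using step by blast
  then show ?case using step by auto
qed

lemma neighbours_friend_tree_subset:
  assumes "\<And>k. k \<ge> 2 \<Longrightarrow> w k \<in> neighbours (friend_tree w k) (a k)" "n \<ge> 2"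
  shows "neighbours (friend_tree w n) i \<subseteq> {1..n}"
  using friend_tree_labels[OF assms] by (fastforce simp: neighbours_def)

text \<open>
  As long as \<open>l\<close> is a leaf attached to \<open>i\<close>, it is a neighbour of \<open>i\<close> only, so it can be selected
  only through \<open>a m = i\<close>. If this never happens, the degree of \<open>l\<close> is constant.
\<close>

lemma temporary_leaf_chosen:
  assumes choice: "\<And>k. k \<ge> 2 \<Longrightarrow> w k \<in> neighbours (friend_tree w k) (a k)"
    and "n \<ge> 2"
    and l: "l \<in> neighbours (friend_tree w n) i" "temporary_leaf w n l"
  shows "\<exists>m\<ge>n. a m = i \<and> w m = l"
proof (rule ccontr)
  assume never: "\<not> ?thesis"
  have "l \<le> n"
    using neighbours_friend_tree_subset[of w a, OF choice \<open>n \<ge> 2\<close>] l(1) by fastforce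
  have "card (neighbours (friend_tree w n) l) = 1"
    using l(2) by (simp add: temporary_leaf_def degree_at_def vertex_degree_def)
  moreover have "i \<in> neighbours (friend_tree w n) l"
    using l(1) neighbours_commute by blast
  ultimately have leaf: "neighbours (friend_tree w n) l = {i}"
    by (metis card_1_singletonE singletonD)
  have const: "neighbours (friend_tree w m) l = {i}" if "m \<ge> n" for m
    using that
  proof (induction m rule: dec_induct)
    case base
    show ?case by (rule leaf)
  next
    case (step m)
    have "w m \<noteq> l"
    proof
      assume "w m = l"
      then have "l \<in> neighbours (friend_tree w m) (a m)"
        using choice[of m] step(1) \<open>n \<ge> 2\<close> by simp
      then have "a m = i"
        using step(3) neighbours_commute by blast
      with \<open>w m = l\<close> step(1) never show False by blast
    qed
    moreover have "Suc m \<noteq> l" using \<open>l \<le> n\<close> step(1) by simp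
    ultimately have "neighbours (friend_tree w (Suc m)) l = neighbours (friend_tree w m) l"
      using step(1) \<open>n \<ge> 2\<close> by (auto simp: neighbours_def doubleton_eq_iff)
    then show ?case using step(3) by simp
  qed
  have deg: "degree_at w m l = 1" if "m \<ge> n" for m
    using const[OF that] by (simp add: degree_at_def vertex_degree_def)
  have "(\<lambda>m. ereal (real (degree_at w m l))) \<longlonglongrightarrow> ereal 1"
    by (rule tendsto_eventually) (use deg in \<open>auto simp: eventually_sequentially intro!: exI[of _ n]\<close>)
  then have "lim (\<lambda>m. ereal (real (degree_at w m l))) = ereal 1"
    by (rule limI)
  then show False
    using l(2) deg[of n] by (simp add: temporary_leaf_def)
qed

lemma liminf_degree_ratio_pos_imp_linear:
  assumes "liminf_degree_ratio w i > 0"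
  shows "\<exists>N. \<forall>m\<ge>N. real (degree_at w m i) \<ge> real m / real (Suc N)"
proof -
  obtain r where "0 < ereal r" and r: "ereal r < liminf_degree_ratio w i"
    using ereal_dense2[OF assms] by auto
  then have "r > 0" by simp
  have "eventually (\<lambda>m. ereal r < ereal (real (degree_at w m i) / real m)) sequentially"
    using less_LiminfD[OF r[unfolded liminf_degree_ratio_def]] .
  then obtain N1 where N1: "\<And>m. m \<ge> N1 \<Longrightarrow> r < real (degree_at w m i) / real m"
    by (auto simp: eventually_sequentially)
  obtain N2 where N2: "inverse (real (Suc N2)) < r"
    using reals_Archimedean[OF \<open>r > 0\<close>] by auto
  define N where "N = max 1 (max N1 N2)"
  have "real m / real (Suc N) \<le> real (degree_at w m i)" if "m \<ge> N" for m
  proof -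
    have "m > 0" "m \<ge> N1" using that by (auto simp: N_def)
    have "1 / real (Suc N) \<le> 1 / real (Suc N2)"
      by (rule divide_left_mono) (auto simp: N_def)
    also have "\<dots> < real (degree_at w m i) / real m"
      using N2 N1[OF \<open>m \<ge> N1\<close>] by (simp add: inverse_eq_divide)
    finally show ?thesis using \<open>m > 0\<close> by (simp add: field_simps)
  qed
  then show ?thesis by blast
qed

section \<open>Probability estimates\<close>

lemma (in prob_space) prob_le_if_le_on_fibres:
  fixes h :: "'a \<Rightarrow> 'b :: countable"
  assumes h: "h \<in> measurable M (count_space UNIV)" and A: "A \<in> sets M" and "c \<ge> 0"
    and le: "\<And>x. prob {\<omega> \<in> A. h \<omega> = x} \<le> c * prob {\<omega> \<in> space M. h \<omega> = x}"
  shows "prob A \<le> c"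
proof -
  have fib: "{\<omega> \<in> space M. h \<omega> = x} \<in> sets M" for x
    using h by measurable
  have "{\<omega> \<in> A. h \<omega> = x} = A \<inter> {\<omega> \<in> space M. h \<omega> = x}" for x
    using sets.sets_into_space[OF A] by auto
  then have fibA: "{\<omega> \<in> A. h \<omega> = x} \<in> sets M" for x
    using fib A by auto
  have "emeasure M A = emeasure M (\<Union>x\<in>UNIV. {\<omega> \<in> A. h \<omega> = x})"
    by (rule arg_cong[where f = "emeasure M"]) auto
  also have "\<dots> = (\<integral>\<^sup>+x. emeasure M {\<omega> \<in> A. h \<omega> = x} \<partial>count_space UNIV)"
    by (rule emeasure_UN_countable) (auto simp: fibA disjoint_family_on_def)
  also have "\<dots> \<le> (\<integral>\<^sup>+x. ennreal c * emeasure M {\<omega> \<in> space M. h \<omega> = x} \<partial>count_space UNIV)"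
    by (rule nn_integral_mono)
       (use le \<open>c \<ge> 0\<close> in \<open>simp add: emeasure_eq_measure flip: ennreal_mult\<close>)
  also have "\<dots> = ennreal c * (\<integral>\<^sup>+x. emeasure M {\<omega> \<in> space M. h \<omega> = x} \<partial>count_space UNIV)"
    by (rule nn_integral_cmult) auto
  also have "(\<integral>\<^sup>+x. emeasure M {\<omega> \<in> space M. h \<omega> = x} \<partial>count_space UNIV)
      = emeasure M (\<Union>x\<in>UNIV. {\<omega> \<in> space M. h \<omega> = x})"
    by (rule emeasure_UN_countable[symmetric]) (auto simp: fib disjoint_family_on_def)
  also have "(\<Union>x\<in>UNIV. {\<omega> \<in> space M. h \<omega> = x}) = space M" by auto
  finally show ?thesis
    using \<open>c \<ge> 0\<close> by (simp add: emeasure_eq_measure prob_space flip: ennreal_mult)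
qed

text \<open>
  Markov's inequality for a count. The first part matters for counts that are only
  dominated by this one and whose own measurability is not known.
\<close>

lemma (in prob_space) prob_card_occurring_le:
  assumes L: "finite L" and B: "\<And>l. l \<in> L \<Longrightarrow> B l \<in> sets M" and "C > 0"
  shows "{\<omega> \<in> space M. real (card {l \<in> L. \<omega> \<in> B l}) \<ge> C} \<in> sets M" (is "?E \<in> _")
    and "prob {\<omega> \<in> space M. real (card {l \<in> L. \<omega> \<in> B l}) \<ge> C} \<le> (\<Sum>l\<in>L. prob (B l)) / C"
proof -
  define X :: "'a \<Rightarrow> real" where "X \<omega> = (\<Sum>l\<in>L. indicator (B l) \<omega>)" for \<omega>
  have X: "real (card {l \<in> L. \<omega> \<in> B l}) = X \<omega>" for \<omega>
    using L by (simp add: X_def indicator_def sum.If_cases Int_def)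
  have int: "integrable M X"
    unfolding X_def[abs_def] using B
    by (intro Bochner_Integration.integrable_sum integrable_real_indicator)
       (auto simp: less_top[symmetric])
  have nonneg: "X \<omega> \<ge> 0" for \<omega>
    by (simp add: X_def sum_nonneg)
  show "?E \<in> sets M"
    unfolding X using borel_measurable_integrable[OF int] by measurable
  have "prob {\<omega> \<in> space M. X \<omega> \<ge> C} \<le> (LINT \<omega>|M. X \<omega>) / C"
    by (rule integral_Markov_inequality_measure[where A = "{}"])
       (use int nonneg \<open>C > 0\<close> in auto)
  also have "(LINT \<omega>|M. X \<omega>) = (\<Sum>l\<in>L. prob (B l))"
    unfolding X_def using B
    by (subst Bochner_Integration.integral_sum) (auto simp: less_top[symmetric])
  finally show "prob {\<omega> \<in> space M. real (card {l \<in> L. \<omega> \<in> B l}) \<ge> C} \<le> (\<Sum>l\<in>L. prob (B l)) / C"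
    unfolding X .
qed

text \<open>The comparison with \<open>2 / m - 2 / (m + 1)\<close> makes the series telescope.\<close>

lemma inverse_squares_tail_le:
  fixes n :: nat
  assumes "n \<ge> 1"
  shows "summable (\<lambda>j. 1 / (real (j + n))\<^sup>2)" and "(\<Sum>j. 1 / (real (j + n))\<^sup>2) \<le> 2 / real n"
proof -
  define g where "g j = 2 / real (j + n)" for j
  have "(\<lambda>j. 2 / real j) \<longlonglongrightarrow> 0"
    by (rule lim_const_over_n)
  then have "g \<longlonglongrightarrow> 0"
    unfolding g_def by (rule LIMSEQ_ignore_initial_segment)
  then have sums: "(\<lambda>j. g j - g (Suc j)) sums (2 / real n)"
    using telescope_sums'[of g 0] by (simp add: g_def)
  have le: "1 / (real (j + n))\<^sup>2 \<le> g j - g (Suc j)" for j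
  proof -
    define x where "x = real (j + n)"
    have "x \<ge> 1" using assms by (simp add: x_def)
    have "1 / x\<^sup>2 \<le> 2 / (x * (x + 1))"
    proof -
      have "x * (x + 1) \<le> 2 * x\<^sup>2"
        using \<open>x \<ge> 1\<close> by (simp add: power2_eq_square algebra_simps)
      then show ?thesis using \<open>x \<ge> 1\<close> by (simp add: divide_simps)
    qed
    also have "\<dots> = 2 / x - 2 / (x + 1)"
      using \<open>x \<ge> 1\<close> by (simp add: field_simps)
    finally show ?thesis by (simp add: g_def x_def add_ac)
  qed
  show summ: "summable (\<lambda>j. 1 / (real (j + n))\<^sup>2)"
    by (rule summable_comparison_test'[OF sums_summable[OF sums], of 0]) (use le in auto)
  have "(\<Sum>j. 1 / (real (j + n))\<^sup>2) \<le> (\<Sum>j. g j - g (Suc j))"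
    by (rule suminf_le[OF le summ sums_summable[OF sums]])
  then show "(\<Sum>j. 1 / (real (j + n))\<^sup>2) \<le> 2 / real n"
    using sums_unique[OF sums] by simp
qed

section \<open>The random friend tree\<close>

context random_friend_tree
begin

text \<open>
  Histories are encoded as lists because these form a countable type; the entry at position
  \<open>k - 2\<close> belongs to time \<open>k\<close>.
\<close>

definition history :: "nat \<Rightarrow> 'a \<Rightarrow> (nat \<times> nat) list" where
  "history m \<omega> = map (\<lambda>k. (V k \<omega>, W k \<omega>)) [2..<m]"

definition tree_of_history :: "nat \<Rightarrow> (nat \<times> nat) list \<Rightarrow> nat set set" where
  "tree_of_history m x = friend_tree (\<lambda>k. snd (x ! (k - 2))) m"

abbreviation tree :: "nat \<Rightarrow> 'a \<Rightarrow> nat set set" where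
  "tree m \<omega> \<equiv> friend_tree (\<lambda>k. W k \<omega>) m"

lemma tree_history: "tree m \<omega> = tree_of_history m (history m \<omega>)"
  unfolding tree_of_history_def
proof (rule friend_tree_cong)
  fix k assume "k \<in> {2..<m}"
  then have "[2..<m] ! (k - 2) = k" "k - 2 < length [2..<m]" by auto
  then show "W k \<omega> = snd (history m \<omega> ! (k - 2))"
    by (simp add: history_def del: length_upt)
qed

lemma history_eq_iff:
  "history m \<omega> = x \<longleftrightarrow> length x = m - 2 \<and>
    (\<forall>k\<in>{2..<m}. V k \<omega> = fst (x ! (k - 2)) \<and> W k \<omega> = snd (x ! (k - 2)))"
proof
  assume "length x = m - 2 \<and>
    (\<forall>k\<in>{2..<m}. V k \<omega> = fst (x ! (k - 2)) \<and> W k \<omega> = snd (x ! (k - 2)))"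
  then show "history m \<omega> = x"
    by (intro nth_equalityI) (auto simp: history_def prod_eq_iff)
next
  assume x: "history m \<omega> = x"
  have "x ! (k - 2) = (V k \<omega>, W k \<omega>)" if "k \<in> {2..<m}" for k
  proof -
    have "[2..<m] ! (k - 2) = k" "k - 2 < length [2..<m]" using that by auto
    then show ?thesis
      by (simp add: history_def del: length_upt flip: x)
  qed
  then show "length x = m - 2 \<and>
    (\<forall>k\<in>{2..<m}. V k \<omega> = fst (x ! (k - 2)) \<and> W k \<omega> = snd (x ! (k - 2)))"
    by (auto simp: history_def simp flip: x)
qed

lemma measurable_history: "history m \<in> measurable M (count_space UNIV)"
proof -
  have "{\<omega> \<in> space M. history m \<omega> = x} \<in> sets M" for x
  proof -
    have "{\<omega> \<in> space M. V k \<omega> = fst (x ! (k - 2)) \<and> W k \<omega> = snd (x ! (k - 2))} \<in> sets M"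
      if "k \<in> {2..<m}" for k
    proof -
      from that have "k \<ge> 2" by simp
      note [measurable] = measurable_V[OF this] measurable_W[OF this]
      show ?thesis by measurable
    qed
    then show ?thesis
      unfolding history_eq_iff
      by (rule sets.sets_Collect_conj[OF sets.sets_Collect_finite_All sets.sets_Collect_const]) simp_all
  qed
  then show ?thesis
    by (subst measurable_count_space_eq2_countable)
       (auto simp: vimage_def Int_def conj_commute)
qed

lemma measurable_tree: "(\<lambda>\<omega>. f (tree m \<omega>)) \<in> measurable M (count_space UNIV)"
  unfolding tree_history by (rule measurable_compose[OF measurable_history]) simp

lemma prob_history_choice_le:
  assumes m: "m \<ge> 2"
  shows "prob {\<omega> \<in> space M. history m \<omega> = x \<and> V m \<omega> = i \<and> W m \<omega> = u}
    \<le> pmf (pmf_of_set {1..m}) i * pmf (pmf_of_set (neighbours (tree_of_history m x) i)) u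
      * prob {\<omega> \<in> space M. history m \<omega> = x}"
proof (cases "length x = m - 2")
  case True
  define H where "H \<omega> \<longleftrightarrow> (\<forall>k\<in>{2..<m}. V k \<omega> = fst (x ! (k - 2)) \<and> W k \<omega> = snd (x ! (k - 2)))" for \<omega>
  have H: "history m \<omega> = x \<longleftrightarrow> H \<omega>" for \<omega>
    using True by (simp add: history_eq_iff H_def)
  have [measurable]: "Measurable.pred M H"
    unfolding H[symmetric] using measurable_history by measurable
  note [measurable] = measurable_V[OF m] measurable_W[OF m]
  have V_cond: "prob {\<omega> \<in> space M. H \<omega> \<and> V m \<omega> = i}
      = pmf (pmf_of_set {1..m}) i * prob {\<omega> \<in> space M. H \<omega>}"
  proof (cases "prob {\<omega> \<in> space M. H \<omega>} = 0")
    case True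
    have "prob {\<omega> \<in> space M. H \<omega> \<and> V m \<omega> = i} \<le> prob {\<omega> \<in> space M. H \<omega>}"
      by (rule finite_measure_mono) auto
    then show ?thesis using True by (simp add: antisym)
  next
    case False
    then have "prob {\<omega> \<in> space M. H \<omega>} > 0" by (simp add: zero_less_measure_iff)
    from uniform_vertex[OF m this[unfolded H_def], of i] False
    show ?thesis by (simp add: cond_prob_def conj_commute field_simps flip: H_def)
  qed
  have W_cond: "prob {\<omega> \<in> space M. H \<omega> \<and> V m \<omega> = i \<and> W m \<omega> = u}
      = pmf (pmf_of_set (neighbours (tree_of_history m x) i)) u
        * prob {\<omega> \<in> space M. H \<omega> \<and> V m \<omega> = i}"
  proof (cases "prob {\<omega> \<in> space M. H \<omega> \<and> V m \<omega> = i} = 0")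
    case True
    have "prob {\<omega> \<in> space M. H \<omega> \<and> V m \<omega> = i \<and> W m \<omega> = u} \<le> prob {\<omega> \<in> space M. H \<omega> \<and> V m \<omega> = i}"
      by (rule finite_measure_mono) auto
    then show ?thesis using True by (simp add: antisym)
  next
    case False
    then have pos: "prob {\<omega> \<in> space M. H \<omega> \<and> V m \<omega> = i} > 0" by (simp add: zero_less_measure_iff)
    have "\<P>(\<omega> in M. W m \<omega> = u \<bar> H \<omega> \<and> V m \<omega> = i)
        = pmf (pmf_of_set (neighbours (tree_of_history m x) i)) u"
      using uniform_neighbour[OF m pos[unfolded H_def], of u]
      unfolding H_def tree_of_history_def .
    moreover have "{\<omega> \<in> space M. W m \<omega> = u \<and> H \<omega> \<and> V m \<omega> = i}
        = {\<omega> \<in> space M. H \<omega> \<and> V m \<omega> = i \<and> W m \<omega> = u}" by auto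
    ultimately show ?thesis
      using False by (simp add: cond_prob_def field_simps)
  qed
  show ?thesis
    unfolding H W_cond V_cond by (simp add: mult_ac)
next
  case False
  then show ?thesis by (simp add: history_eq_iff)
qed

text \<open>
  The law of total probability over the histories: a bound on the one-step probability that is
  valid in every tree satisfying \<open>Q\<close> becomes a bound on an unconditional probability.
\<close>

lemma prob_tree_choice_le:
  assumes m: "m \<ge> 2" and "c \<ge> 0"
    and le: "\<And>w. Q (friend_tree w m) \<Longrightarrow>
      pmf (pmf_of_set {1..m}) i * pmf (pmf_of_set (neighbours (friend_tree w m) i)) u \<le> c"
  shows "{\<omega> \<in> space M. Q (tree m \<omega>) \<and> V m \<omega> = i \<and> W m \<omega> = u} \<in> sets M" (is "?A \<in> _")
    and "prob {\<omega> \<in> space M. Q (tree m \<omega>) \<and> V m \<omega> = i \<and> W m \<omega> = u} \<le> c"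
proof -
  note [measurable] = measurable_V[OF m] measurable_W[OF m] measurable_tree[of Q m]
  show A: "?A \<in> sets M" by measurable
  show "prob ?A \<le> c"
  proof (rule prob_le_if_le_on_fibres[OF measurable_history[of m] A \<open>c \<ge> 0\<close>])
    fix x
    show "prob {\<omega> \<in> ?A. history m \<omega> = x} \<le> c * prob {\<omega> \<in> space M. history m \<omega> = x}"
    proof (cases "Q (tree_of_history m x)")
      case True
      have "{\<omega> \<in> ?A. history m \<omega> = x}
          = {\<omega> \<in> space M. history m \<omega> = x \<and> V m \<omega> = i \<and> W m \<omega> = u}"
        using True tree_history by auto
      then show ?thesis
        using prob_history_choice_le[OF m, of x i u] True
        by (auto simp: tree_of_history_def intro!: order.trans[OF _ mult_right_mono[OF le]])
    next
      case False
      then have "{\<omega> \<in> ?A. history m \<omega> = x} = {}"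
        using tree_history by auto
      then show ?thesis using \<open>c \<ge> 0\<close> by (simp only: measure_empty) simp
    qed
  qed
qed

text \<open>
  A uniform law on a finite nonempty set gives no mass outside of this set, and every vertex of
  \<open>{1..m}\<close> has a neighbour at time \<open>m\<close>; other values of \<open>V m\<close> are null.
\<close>

lemma AE_choice_neighbour:
  "AE \<omega> in M. \<forall>m\<ge>2. W m \<omega> \<in> neighbours (tree m \<omega>) (V m \<omega>)"
proof -
  have "AE \<omega> in M. \<not> (u \<notin> neighbours (tree m \<omega>) i \<and> V m \<omega> = i \<and> W m \<omega> = u)"
    if m: "m \<ge> 2" for m i u
  proof -
    have "pmf (pmf_of_set {1..m}) i * pmf (pmf_of_set (neighbours (friend_tree w m) i)) u \<le> 0"
      if "u \<notin> neighbours (friend_tree w m) i" for w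
    proof (cases "i \<in> {1..m}")
      case True
      then show ?thesis
        using that neighbours_friend_tree_nonempty[OF m True, of w]
        by (simp add: finite_neighbours finite_friend_tree)
    next
      case False
      then show ?thesis using m by simp
    qed
    note * = prob_tree_choice_le[where Q = "\<lambda>E. u \<notin> neighbours E i", OF m order.refl this]
    have "prob {\<omega> \<in> space M. u \<notin> neighbours (tree m \<omega>) i \<and> V m \<omega> = i \<and> W m \<omega> = u} = 0"
      using *(2) by (simp add: antisym)
    with *(1) show ?thesis
      by (subst AE_iff_measurable[OF *(1)]) (auto simp: emeasure_eq_measure)
  qed
  then have "AE \<omega> in M. \<forall>m. m \<ge> 2 \<longrightarrow>
      (\<forall>i u. \<not> (u \<notin> neighbours (tree m \<omega>) i \<and> V m \<omega> = i \<and> W m \<omega> = u))"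
    by (intro AE_all_countable[THEN iffD2] allI AE_impI) blast
  then show ?thesis by eventually_elim blast
qed

definition chosen_from :: "real \<Rightarrow> nat \<Rightarrow> nat \<Rightarrow> nat \<Rightarrow> 'a set" where
  "chosen_from \<delta> i u m = {\<omega> \<in> space M.
     \<delta> * real m \<le> real (degree_at (\<lambda>k. W k \<omega>) m i) \<and> V m \<omega> = i \<and> W m \<omega> = u}"

lemma prob_chosen_from_at_le:
  assumes m: "m \<ge> 2" and "\<delta> > 0"
  shows "chosen_from \<delta> i u m \<in> sets M" and "prob (chosen_from \<delta> i u m) \<le> 1 / (\<delta> * (real m)\<^sup>2)"
proof -
  have "pmf (pmf_of_set {1..m}) i * pmf (pmf_of_set (neighbours (friend_tree w m) i)) u
      \<le> 1 / (\<delta> * (real m)\<^sup>2)"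
    if deg: "\<delta> * real m \<le> real (vertex_degree (friend_tree w m) i)" for w
  proof -
    \<comment> \<open>The uniform law is meaningful here: a positive degree excludes the empty neighbourhood.\<close>
    have "\<delta> * real m > 0" using assms by simp
    then have card: "\<delta> * real m \<le> real (card (neighbours (friend_tree w m) i))"
      and "card (neighbours (friend_tree w m) i) > 0"
      using deg by (auto simp: vertex_degree_def intro: gr0I)
    then have "pmf (pmf_of_set (neighbours (friend_tree w m) i)) u
        \<le> 1 / real (card (neighbours (friend_tree w m) i))"
      by (subst pmf_of_set) (auto simp: card_gt_0_iff indicator_def)
    also have "\<dots> \<le> 1 / (\<delta> * real m)"
      using card \<open>\<delta> * real m > 0\<close> by (intro divide_left_mono) auto
    finally have "pmf (pmf_of_set {1..m}) i * pmf (pmf_of_set (neighbours (friend_tree w m) i)) u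
        \<le> (1 / real m) * (1 / (\<delta> * real m))"
      using m by (intro mult_mono) (auto simp: indicator_def)
    then show ?thesis by (simp add: power2_eq_square mult_ac)
  qed
  note * = prob_tree_choice_le[where Q = "\<lambda>E. \<delta> * real m \<le> real (vertex_degree E i)", OF m _ this]
  show "chosen_from \<delta> i u m \<in> sets M" "prob (chosen_from \<delta> i u m) \<le> 1 / (\<delta> * (real m)\<^sup>2)"
    unfolding chosen_from_def degree_at_def using * \<open>\<delta> > 0\<close> by auto
qed

lemma prob_chosen_from_le:
  assumes n: "n \<ge> 2" and "\<delta> > 0"
  shows "(\<Union>m\<in>{n..}. chosen_from \<delta> i u m) \<in> sets M"
    and "prob (\<Union>m\<in>{n..}. chosen_from \<delta> i u m) \<le> 2 / (\<delta> * real n)"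
proof -
  have sets: "chosen_from \<delta> i u m \<in> sets M" if "m \<ge> n" for m
    using prob_chosen_from_at_le(1)[OF _ \<open>\<delta> > 0\<close>, of m] that n by simp
  then show "(\<Union>m\<in>{n..}. chosen_from \<delta> i u m) \<in> sets M" by auto
  have le: "prob (chosen_from \<delta> i u (j + n)) \<le> 1 / \<delta> * (1 / (real (j + n))\<^sup>2)" for j
    using prob_chosen_from_at_le(2)[OF _ \<open>\<delta> > 0\<close>, of "j + n"] n by simp
  have summ: "summable (\<lambda>j. 1 / \<delta> * (1 / (real (j + n))\<^sup>2))"
    using inverse_squares_tail_le(1)[of n] n by (intro summable_mult) auto
  have summ': "summable (\<lambda>j. prob (chosen_from \<delta> i u (j + n)))"
    by (rule summable_comparison_test'[OF summ, of 0]) (use le in simp)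
  have "(\<Union>m\<in>{n..}. chosen_from \<delta> i u m) = (\<Union>j. chosen_from \<delta> i u (j + n))"
  proof (intro equalityI subsetI)
    fix \<omega> assume "\<omega> \<in> (\<Union>m\<in>{n..}. chosen_from \<delta> i u m)"
    then obtain m where "m \<ge> n" "\<omega> \<in> chosen_from \<delta> i u m" by blast
    then have "\<omega> \<in> chosen_from \<delta> i u ((m - n) + n)" by simp
    then show "\<omega> \<in> (\<Union>j. chosen_from \<delta> i u (j + n))" by blast
  qed (auto simp del: add_is_0)
  then have "prob (\<Union>m\<in>{n..}. chosen_from \<delta> i u m) = prob (\<Union>j. chosen_from \<delta> i u (j + n))"
    by simp
  also have "\<dots> \<le> (\<Sum>j. prob (chosen_from \<delta> i u (j + n)))"
    by (rule finite_measure_subadditive_countably) (use sets summ' in auto)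
  also have "\<dots> \<le> (\<Sum>j. 1 / \<delta> * (1 / (real (j + n))\<^sup>2))"
    by (rule suminf_le[OF le summ' summ])
  also have "\<dots> = 1 / \<delta> * (\<Sum>j. 1 / (real (j + n))\<^sup>2)"
    using inverse_squares_tail_le(1)[of n] n by (intro suminf_mult) auto
  also have "\<dots> \<le> 1 / \<delta> * (2 / real n)"
    using inverse_squares_tail_le(2)[of n] n \<open>\<delta> > 0\<close> by (intro mult_left_mono) auto
  finally show "prob (\<Union>m\<in>{n..}. chosen_from \<delta> i u m) \<le> 2 / (\<delta> * real n)" by simp
qed

text \<open>
  The exceptional event in the truncation of \<open>Z\<^sub>i > 0\<close>. One parameter \<open>N\<close> governs both the slope
  and the starting time, so that these events decrease in \<open>N\<close>.
\<close>

definition degree_dips :: "nat \<Rightarrow> nat \<Rightarrow> 'a set" where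
  "degree_dips i N = {\<omega> \<in> space M. liminf_degree_ratio (\<lambda>k. W k \<omega>) i > 0 \<and>
     (\<exists>m\<ge>N. real (degree_at (\<lambda>k. W k \<omega>) m i) < real m / real (Suc N))}"

lemma sets_degree_dips:
  assumes "{\<omega> \<in> space M. liminf_degree_ratio (\<lambda>k. W k \<omega>) i > 0} \<in> sets M"
  shows "degree_dips i N \<in> sets M"
proof -
  have "{\<omega> \<in> space M. real (degree_at (\<lambda>k. W k \<omega>) m i) < real m / real (Suc N)} \<in> sets M" for m
    using measurable_tree[of "\<lambda>E. real (vertex_degree E i) < real m / real (Suc N)" m]
    unfolding degree_at_def by measurable
  then show ?thesis
    unfolding degree_dips_def
    by (intro sets.sets_Collect_conj assms sets.sets_Collect_countable_Ex sets.sets_Collect_const)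
qed

lemma prob_degree_dips_tendsto_0:
  assumes "{\<omega> \<in> space M. liminf_degree_ratio (\<lambda>k. W k \<omega>) i > 0} \<in> sets M"
  shows "(\<lambda>N. prob (degree_dips i N)) \<longlonglongrightarrow> 0"
proof -
  have "decseq (degree_dips i)"
  proof (rule decseq_SucI, rule subsetI)
    fix N \<omega> assume "\<omega> \<in> degree_dips i (Suc N)"
    then obtain m where m: "m \<ge> Suc N"
      "real (degree_at (\<lambda>k. W k \<omega>) m i) < real m / real (Suc (Suc N))"
      and \<omega>: "\<omega> \<in> space M" "liminf_degree_ratio (\<lambda>k. W k \<omega>) i > 0"
      by (auto simp: degree_dips_def)
    have "real m / real (Suc (Suc N)) \<le> real m / real (Suc N)"
      by (intro divide_left_mono) auto
    with m have "m \<ge> N" "real (degree_at (\<lambda>k. W k \<omega>) m i) < real m / real (Suc N)"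
      by linarith+
    with \<omega> show "\<omega> \<in> degree_dips i N" unfolding degree_dips_def by blast
  qed
  moreover have "(\<Inter>N. degree_dips i N) = {}"
  proof (rule ccontr)
    assume "(\<Inter>N. degree_dips i N) \<noteq> {}"
    then obtain \<omega> where \<omega>: "\<And>N. \<omega> \<in> degree_dips i N" by blast
    then have "liminf_degree_ratio (\<lambda>k. W k \<omega>) i > 0"
      by (auto simp: degree_dips_def)
    from liminf_degree_ratio_pos_imp_linear[OF this] obtain N where
      "\<forall>m\<ge>N. real (degree_at (\<lambda>k. W k \<omega>) m i) \<ge> real m / real (Suc N)" by blast
    with \<omega>[of N] show False unfolding degree_dips_def by force
  qed
  ultimately show ?thesis
    using finite_Lim_measure_decseq[of "degree_dips i"] sets_degree_dips[OF assms]
    by (auto simp: image_subset_iff)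
qed

lemma num_temporary_leaves_le:
  assumes choice: "\<And>k. k \<ge> 2 \<Longrightarrow> W k \<omega> \<in> neighbours (tree k \<omega>) (V k \<omega>)"
    and n: "n \<ge> 2"
  shows "num_temporary_leaves (\<lambda>k. W k \<omega>) n i \<le> n"
proof -
  have "{l \<in> neighbours (tree n \<omega>) i. temporary_leaf (\<lambda>k. W k \<omega>) n l} \<subseteq> {1..n}"
    using neighbours_friend_tree_subset[of "\<lambda>k. W k \<omega>" "\<lambda>k. V k \<omega>", OF choice n] by blast
  from card_mono[OF _ this] show ?thesis
    by (simp add: num_temporary_leaves_def)
qed

lemma num_temporary_leaves_le_card_chosen:
  assumes choice: "\<And>k. k \<ge> 2 \<Longrightarrow> W k \<omega> \<in> neighbours (tree k \<omega>) (V k \<omega>)"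
    and n: "n \<ge> 2" and \<omega>: "\<omega> \<in> space M"
    and deg: "\<And>m. m \<ge> n \<Longrightarrow> \<delta> * real m \<le> real (degree_at (\<lambda>k. W k \<omega>) m i)"
  shows "num_temporary_leaves (\<lambda>k. W k \<omega>) n i
    \<le> card {l \<in> {1..n}. \<omega> \<in> (\<Union>m\<in>{n..}. chosen_from \<delta> i l m)}"
  unfolding num_temporary_leaves_def
proof (rule card_mono)
  show "{l \<in> neighbours (tree n \<omega>) i. temporary_leaf (\<lambda>k. W k \<omega>) n l}
    \<subseteq> {l \<in> {1..n}. \<omega> \<in> (\<Union>m\<in>{n..}. chosen_from \<delta> i l m)}"
  proof
    fix l assume l: "l \<in> {l \<in> neighbours (tree n \<omega>) i. temporary_leaf (\<lambda>k. W k \<omega>) n l}"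
    then have "l \<in> {1..n}"
      using neighbours_friend_tree_subset[of "\<lambda>k. W k \<omega>" "\<lambda>k. V k \<omega>", OF choice n] by blast
    obtain m where "m \<ge> n" "V m \<omega> = i" "W m \<omega> = l"
      using temporary_leaf_chosen[of "\<lambda>k. W k \<omega>" "\<lambda>k. V k \<omega>", OF choice n] l by blast
    with deg \<omega> have "\<omega> \<in> chosen_from \<delta> i l m" by (auto simp: chosen_from_def)
    with \<open>l \<in> {1..n}\<close> \<open>m \<ge> n\<close> show "l \<in> {l \<in> {1..n}. \<omega> \<in> (\<Union>m\<in>{n..}. chosen_from \<delta> i l m)}"
      by blast
  qed
qed simp

text \<open>
  Tightness up to the probability of \<open>degree_dips i N\<close>, since the bound does not depend on \<open>n\<close>.
\<close>

lemma prob_many_temporary_leaves_le: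
  assumes Z: "{\<omega> \<in> space M. liminf_degree_ratio (\<lambda>k. W k \<omega>) i > 0} \<in> sets M"
    and n: "n \<ge> 2" and "C > 0" "C \<ge> real N"
  shows "prob {\<omega> \<in> space M. real (num_temporary_leaves (\<lambda>k. W k \<omega>) n i) > C \<and>
        liminf_degree_ratio (\<lambda>k. W k \<omega>) i > 0}
    \<le> prob (degree_dips i N) + 2 * real (Suc N) / C" (is "prob ?S \<le> _")
proof -
  define \<delta> where "\<delta> = 1 / real (Suc N)"
  define B where "B l = (\<Union>m\<in>{n..}. chosen_from \<delta> i l m)" for l
  define many where "many = {\<omega> \<in> space M. real (card {l \<in> {1..n}. \<omega> \<in> B l}) \<ge> C}"
  have "\<delta> > 0" by (simp add: \<delta>_def)
  have B: "B l \<in> sets M" "prob (B l) \<le> 2 / (\<delta> * real n)" for l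
    using prob_chosen_from_le[OF n \<open>\<delta> > 0\<close>] by (auto simp: B_def)
  have many_sets: "many \<in> sets M"
    using prob_card_occurring_le(1)[of "{1..n}" B C] B \<open>C > 0\<close> by (simp add: many_def)
  have "prob many \<le> (\<Sum>l\<in>{1..n}. prob (B l)) / C"
    using prob_card_occurring_le(2)[of "{1..n}" B C] B \<open>C > 0\<close> by (simp add: many_def)
  also have "\<dots> \<le> (\<Sum>l\<in>{1..n}. 2 / (\<delta> * real n)) / C"
    using B \<open>C > 0\<close> by (intro divide_right_mono sum_mono) auto
  also have "\<dots> = 2 * real (Suc N) / C"
    using n by (simp add: \<delta>_def)
  finally have many: "prob many \<le> 2 * real (Suc N) / C" .
  obtain null where null: "null \<in> null_sets M"
    "{\<omega> \<in> space M. \<not> (\<forall>m\<ge>2. W m \<omega> \<in> neighbours (tree m \<omega>) (V m \<omega>))} \<subseteq> null"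
    using AE_choice_neighbour unfolding eventually_ae_filter by blast
  have "?S \<subseteq> null \<union> (degree_dips i N \<union> many)"
  proof
    fix \<omega> assume S: "\<omega> \<in> ?S"
    show "\<omega> \<in> null \<union> (degree_dips i N \<union> many)"
    proof (rule ccontr)
      assume out: "\<omega> \<notin> null \<union> (degree_dips i N \<union> many)"
      with S null(2) have choice: "\<And>k. k \<ge> 2 \<Longrightarrow> W k \<omega> \<in> neighbours (tree k \<omega>) (V k \<omega>)"
        by blast
      \<comment> \<open>There are at most \<open>n\<close> temporary leaves, so more than \<open>C \<ge> N\<close> of them occur only late.\<close>
      have "n \<ge> N"
        using num_temporary_leaves_le[OF choice n, of i] S \<open>C \<ge> real N\<close> by simp
      have "\<delta> * real m \<le> real (degree_at (\<lambda>k. W k \<omega>) m i)" if "m \<ge> n" for m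
      proof -
        have "m \<ge> N" using that \<open>n \<ge> N\<close> by simp
        with out S have "\<not> real (degree_at (\<lambda>k. W k \<omega>) m i) < real m / real (Suc N)"
          unfolding degree_dips_def by blast
        then show ?thesis by (simp add: \<delta>_def)
      qed
      from num_temporary_leaves_le_card_chosen[OF choice n _ this] S
      have "\<omega> \<in> many" by (auto simp: many_def B_def)
      with out show False by blast
    qed
  qed
  then have "prob ?S \<le> prob (null \<union> (degree_dips i N \<union> many))"
    using null(1) sets_degree_dips[OF Z] many_sets by (intro finite_measure_mono) auto
  also have "\<dots> \<le> prob null + (prob (degree_dips i N) + prob many)"
    using null(1) sets_degree_dips[OF Z] many_sets
    by (intro order.trans[OF measure_Un_le] add_left_mono measure_Un_le) auto
  also have "prob null = 0"
    using null(1) by (rule measure_eq_0_null_sets)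
  finally show ?thesis using many by simp
qed

end

theorem proposition5p1:
  fixes M :: "'a measure" and V W :: "nat \<Rightarrow> 'a \<Rightarrow> nat" and v :: nat
  assumes "random_friend_tree M V W"
    and "v \<ge> 1"
    and "\<P>(\<omega> in M. liminf_degree_ratio (\<lambda>k. W k \<omega>) v > 0) > 0"
  shows "\<forall>\<epsilon>>0. \<exists>C>0. \<forall>n\<ge>max v 2.
    \<P>(\<omega> in M. real (num_temporary_leaves (\<lambda>k. W k \<omega>) n v) > C \<bar> liminf_degree_ratio (\<lambda>k. W k \<omega>) v > 0) < \<epsilon>"
proof (intro allI impI)
  interpret random_friend_tree M V W by (rule assms(1))
  fix \<epsilon> :: real assume "\<epsilon> > 0"
  define p where "p = \<P>(\<omega> in M. liminf_degree_ratio (\<lambda>k. W k \<omega>) v > 0)"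
  have "p > 0" using assms(3) by (simp add: p_def)
  have Z: "{\<omega> \<in> space M. liminf_degree_ratio (\<lambda>k. W k \<omega>) v > 0} \<in> sets M"
    using assms(3) measure_notin_sets by fastforce
  have "eventually (\<lambda>N. prob (degree_dips v N) < \<epsilon> * p / 2) sequentially"
    by (rule order_tendstoD(2)[OF prob_degree_dips_tendsto_0[OF Z]])
       (use \<open>\<epsilon> > 0\<close> \<open>p > 0\<close> in simp)
  then obtain N where N: "prob (degree_dips v N) < \<epsilon> * p / 2"
    by (auto simp: eventually_sequentially)
  \<comment> \<open>The second summand makes the Markov bound at most \<open>\<epsilon> * p / 2\<close>, the first one covers \<open>n < N\<close>.\<close>
  define C where "C = real N + 4 * real (Suc N) / (\<epsilon> * p)"
  have "4 * real (Suc N) / (\<epsilon> * p) > 0"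
    using \<open>\<epsilon> > 0\<close> \<open>p > 0\<close> by simp
  then have C: "C > 0" "C \<ge> real N" "C \<ge> 4 * real (Suc N) / (\<epsilon> * p)"
    by (auto simp: C_def)
  then have markov: "2 * real (Suc N) / C \<le> \<epsilon> * p / 2"
    using \<open>\<epsilon> > 0\<close> \<open>p > 0\<close> by (simp add: field_simps)
  have "\<P>(\<omega> in M. real (num_temporary_leaves (\<lambda>k. W k \<omega>) n v) > C \<bar>
      liminf_degree_ratio (\<lambda>k. W k \<omega>) v > 0) < \<epsilon>" if "n \<ge> max v 2" for n
  proof -
    have "n \<ge> 2" using that by simp
    from prob_many_temporary_leaves_le[OF Z this C(1,2)] N markov
    have "prob {\<omega> \<in> space M. real (num_temporary_leaves (\<lambda>k. W k \<omega>) n v) > C \<and>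
        liminf_degree_ratio (\<lambda>k. W k \<omega>) v > 0} < \<epsilon> * p" by linarith
    then show ?thesis
      using \<open>p > 0\<close> by (simp add: cond_prob_def p_def[symmetric] pos_divide_less_eq)
  qed
  with C(1) show "\<exists>C>0. \<forall>n\<ge>max v 2.
    \<P>(\<omega> in M. real (num_temporary_leaves (\<lambda>k. W k \<omega>) n v) > C \<bar> liminf_degree_ratio (\<lambda>k. W k \<omega>) v > 0) < \<epsilon>"
    by blast
qed

end
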